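(* No online algorithm can be better than $\min\big\{\log^{1-o(1)}\mu^*,\ \frac{N-1}{e}\big\}$-competitive, where $N$ is the number of agents and $\mu^*$ is the impartiality ratio of the instance; that is, for every online algorithm, the worst-case ratio of the optimal Nash welfare to the algorithm's (expected) Nash welfare over instances with $N$ agents and impartiality ratio at most $\mu^*$ is at least $\min\{\log^{1-o(1)}\mu^*, \frac{N-1}{e}\}$.
   Context: There are $N$ agents and divisible items arriving online; item $t$ has supply $s_t>0$ and agent $i$ has value $v_{it}\ge0$ per unit of item $t$. An allocation $(x_{it})$ is non-negative with $\sum_i x_{it}\le s_t$; utilities are $u_i=\sum_t x_{it}v_{it}$ and the Nash welfare is $(\prod_i u_i)^{1/N}$. An online algorithm allocates each item irrevocably upon arrival, seeing only the supply of and the values for items arrived so far. An allocation with utilities $(u_i)$ is $\mu$-impartial if $u_i\le\mu u_j$ for all $i,j$; an instance is $\mu$-impartial if every Nash welfare maximizing allocation is $\mu$-impartial; the impartiality ratio $\mu^*$ is the smallest such $\mu$. Logarithms are natural; $o(1)$ denotes a term tending to $0$ as its argument grows. *)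

theory Defs
  imports "HOL-Probability.Probability"
begin

text \<open>Agents are the numbers \<open>i < N\<close>. They are not a finite type, because the error term in
  the theorem has to be chosen uniformly in \<open>N\<close>.\<close>

record item =
  item_supply :: real
  item_value :: "nat \<Rightarrow> real"

text \<open>Values vanish outside \<open>{..<N}\<close>, so an item carries no information beyond its supply
  and the values of the \<open>N\<close> agents. An instance lists its items in order of arrival.\<close>

definition valid_item :: "nat \<Rightarrow> item \<Rightarrow> bool" where
  "valid_item N it \<longleftrightarrow>
     0 < item_supply it \<and> (\<forall>i<N. 0 \<le> item_value it i) \<and> (\<forall>i\<ge>N. item_value it i = 0)"

definition instances :: "nat \<Rightarrow> item list set" where
  "instances N = {I. \<forall>it\<in>set I. valid_item N it}"

text \<open>In an allocation \<open>x\<close>, the amount of item \<open>t\<close> given to agent \<open>i\<close> is \<open>x i t\<close>.\<close>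

definition allocations :: "nat \<Rightarrow> item list \<Rightarrow> (nat \<Rightarrow> nat \<Rightarrow> real) set" where
  "allocations N I =
     {x. \<forall>t<length I. (\<forall>i<N. 0 \<le> x i t) \<and> (\<Sum>i<N. x i t) \<le> item_supply (I ! t)}"

definition utility :: "item list \<Rightarrow> (nat \<Rightarrow> nat \<Rightarrow> real) \<Rightarrow> nat \<Rightarrow> real" where
  "utility I x i = (\<Sum>t<length I. x i t * item_value (I ! t) i)"

definition nash_welfare :: "nat \<Rightarrow> item list \<Rightarrow> (nat \<Rightarrow> nat \<Rightarrow> real) \<Rightarrow> real" where
  "nash_welfare N I x = root N (\<Prod>i<N. utility I x i)"

definition optimal_nash_welfare :: "nat \<Rightarrow> item list \<Rightarrow> real" where
  "optimal_nash_welfare N I = (SUP x\<in>allocations N I. nash_welfare N I x)"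

definition nash_maximizing :: "nat \<Rightarrow> item list \<Rightarrow> (nat \<Rightarrow> nat \<Rightarrow> real) \<Rightarrow> bool" where
  "nash_maximizing N I x \<longleftrightarrow>
     x \<in> allocations N I \<and> (\<forall>y\<in>allocations N I. nash_welfare N I y \<le> nash_welfare N I x)"

definition impartial_allocation ::
  "nat \<Rightarrow> real \<Rightarrow> item list \<Rightarrow> (nat \<Rightarrow> nat \<Rightarrow> real) \<Rightarrow> bool" where
  "impartial_allocation N \<mu> I x \<longleftrightarrow> (\<forall>i<N. \<forall>j<N. utility I x i \<le> \<mu> * utility I x j)"

definition impartial_instance :: "nat \<Rightarrow> real \<Rightarrow> item list \<Rightarrow> bool" where
  "impartial_instance N \<mu> I \<longleftrightarrow>
     (\<forall>x. nash_maximizing N I x \<longrightarrow> impartial_allocation N \<mu> I x)"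

text \<open>The values are extended reals so that an instance that is impartial for no \<open>\<mu>\<close> (the optimal
  Nash welfare is 0, but some agent can obtain positive utility) has ratio \<open>\<infinity>\<close>.\<close>

definition impartiality_ratio :: "nat \<Rightarrow> item list \<Rightarrow> ennreal" where
  "impartiality_ratio N I = (INF \<mu>\<in>{\<mu>. impartial_instance N \<mu> I}. ennreal \<mu>)"

text \<open>A deterministic online algorithm maps the nonempty list \<open>h\<close> of items that have arrived so
  far to the amounts \<open>A h i\<close> of the latest item, \<open>last h\<close>, given to the agents \<open>i\<close>. Its earlier
  decisions are determined by \<open>h\<close>. The number of items to come is not revealed.\<close>

type_synonym algorithm = "item list \<Rightarrow> nat \<Rightarrow> real"

definition deterministic_online_algorithms :: "nat \<Rightarrow> algorithm set" where
  "deterministic_online_algorithms N =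
     {A. \<forall>h\<in>instances N. h \<noteq> [] \<longrightarrow>
           (\<forall>i<N. 0 \<le> A h i) \<and> (\<Sum>i<N. A h i) \<le> item_supply (last h)}"

definition online_allocation :: "algorithm \<Rightarrow> item list \<Rightarrow> nat \<Rightarrow> nat \<Rightarrow> real" where
  "online_allocation A I i t = A (take (Suc t) I) i"

text \<open>An online algorithm is a probability distribution over deterministic ones; point masses are
  the deterministic algorithms. An algorithm driven by random bits from an arbitrary probability
  space is covered, by taking the distribution of the induced deterministic algorithm.\<close>

definition online_algorithm :: "nat \<Rightarrow> algorithm measure \<Rightarrow> bool" where
  "online_algorithm N M \<longleftrightarrow>
     prob_space M \<and>
     space M \<subseteq> deterministic_online_algorithms N \<and>
     (\<forall>h\<in>instances N. h \<noteq> [] \<longrightarrow> (\<forall>i<N. (\<lambda>A. A h i) \<in> borel_measurable M))"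

definition expected_nash_welfare :: "nat \<Rightarrow> algorithm measure \<Rightarrow> item list \<Rightarrow> real" where
  "expected_nash_welfare N M I =
     (\<integral>A. nash_welfare N I (online_allocation A I) \<partial>M)"

text \<open>In \<^typ>\<open>ennreal\<close>, a quotient with denominator 0 is \<open>\<infinity>\<close> if the numerator is positive, and
  0 if it is 0. So an instance with optimal Nash welfare 0 does not affect the supremum.\<close>

definition competitive_ratio :: "nat \<Rightarrow> real \<Rightarrow> algorithm measure \<Rightarrow> ennreal" where
  "competitive_ratio N \<mu> M =
     (SUP I\<in>{I \<in> instances N. impartiality_ratio N I \<le> ennreal \<mu>}.
        ennreal (optimal_nash_welfare N I) / ennreal (expected_nash_welfare N M I))"

end

theory Submission
  imports Defs "HOL-Combinatorics.Permutations" "HOL-Real_Asymp.Real_Asymp"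
begin

text \<open>The hard instances have \<open>N\<close> items of supply 1. For a permutation \<open>p\<close> of the agents and \<open>V \<ge> 1\<close>,
  item \<open>t\<close> is worth \<open>V ^ t\<close> to each of the agents \<open>p t, \<dots>, p (N - 1)\<close> and nothing to the others. The
  diagonal allocation, which gives item \<open>t\<close> to \<open>p t\<close>, is optimal, and its utilities are spread by
  a factor of \<open>V ^ (N - 1)\<close>. If \<open>p\<close> is random, an online algorithm cannot
  tell \<open>p j\<close> apart from the \<open>N - s\<close> agents that value item \<open>s \<le> j\<close>, so it gives \<open>p j\<close> at most
  \<open>1 / (N - s)\<close> of the item in expectation. The AM-GM inequality with weights \<open>N - j\<close> then bounds its
  expected Nash welfare by the optimum times \<open>(N!) powr (- 1 / N) * V / (V - 1)\<close>.
  With \<open>V = \<mu> powr (1 / (N - 1))\<close> and \<open>N! \<ge> (N / e) ^ N\<close>, the competitive ratio is at least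
  \<open>(N / e) * (1 - 1 / V)\<close>. This is at least \<open>(N - 1) / e\<close> if \<open>V \<ge> N\<close>, and otherwise at least
  \<open>ln \<mu>\<close> up to a factor of order \<open>ln (ln \<mu>)\<close>.\<close>

section \<open>AM-GM, its equality case, and a lower bound for factorials\<close>

lemma root_arith_geom_mean:
  fixes a :: "nat \<Rightarrow> real"
  assumes "0 < N" and a: "\<And>i. i < N \<Longrightarrow> 0 \<le> a i"
  shows "root N (\<Prod>i<N. a i) \<le> (\<Sum>i<N. a i) / real N"
proof (cases "(\<Prod>i<N. a i) = 0")
  case True
  have "0 \<le> (\<Sum>i<N. a i)" using a by (intro sum_nonneg) auto
  then show ?thesis by (simp add: True)
next
  case False
  moreover have "0 \<le> (\<Prod>i<N. a i)" using a by (intro prod_nonneg) auto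
  ultimately have "0 < (\<Prod>i<N. a i)" by linarith
  then have "root N (\<Prod>i<N. a i) = (\<Prod>i<N. a i) powr (1 / real N)"
    using \<open>0 < N\<close> by (simp add: root_powr_inverse)
  also have "\<dots> \<le> (\<Sum>i<N. a i / real N)"
    using arith_geom_mean[of "{..<N}" a] assms by auto
  finally show ?thesis by (simp add: sum_divide_distrib)
qed

text \<open>The terms \<open>a i - 1 - ln (a i)\<close> are nonnegative, and the conditions on
  product and sum force their total to be at most 0. So each term vanishes, which for positive
  \<open>a i\<close> happens only at 1.\<close>

lemma arith_geom_mean_eq:
  fixes a :: "nat \<Rightarrow> real"
  assumes a: "\<And>i. i < N \<Longrightarrow> 0 \<le> a i"
    and prod: "(\<Prod>i<N. a i) = 1" and sum: "(\<Sum>i<N. a i) \<le> real N"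
    and "j < N"
  shows "a j = 1"
proof -
  have pos: "0 < a i" if "i < N" for i
  proof -
    have "a i \<noteq> 0" using prod that by (metis finite_lessThan lessThan_iff prod_zero zero_neq_one)
    then show ?thesis using a[OF that] by simp
  qed
  have "ln (\<Prod>i<N. a i) = (\<Sum>i<N. ln (a i))"
    using pos by (intro ln_prod) force+
  then have "(\<Sum>i<N. ln (a i)) = 0" using prod by simp
  then have "(\<Sum>i<N. a i - 1 - ln (a i)) \<le> 0"
    using sum by (simp add: sum_subtractf)
  moreover have nonneg: "0 \<le> a i - 1 - ln (a i)" if "i < N" for i
    using ln_le_minus_one[OF pos[OF that]] by simp
  ultimately have "(\<Sum>i<N. a i - 1 - ln (a i)) = 0"
    by (intro antisym sum_nonneg) auto
  then have "a j - 1 - ln (a j) = 0"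
    using nonneg \<open>j < N\<close> by (subst (asm) sum_nonneg_eq_0_iff) auto
  then show ?thesis using ln_eq_minus_one pos[OF \<open>j < N\<close>] by simp
qed

text \<open>The number \<open>n ^ n / fact n\<close> is a single term of the exponential series for
  \<open>exp n\<close>.\<close>

lemma power_div_exp_le_fact: "(real n / exp 1) ^ n \<le> fact n"
proof -
  have "real n ^ n /\<^sub>R fact n \<le> exp (real n)"
    using sum_le_suminf[OF summable_exp_generic, of "{n}" "real n"]
    by (simp add: exp_def)
  then have "real n ^ n \<le> exp 1 ^ n * fact n"
    by (simp add: field_simps flip: exp_of_nat_mult)
  then show ?thesis by (simp add: power_divide field_simps)
qed

section \<open>Triangular instances and their utilities\<close>

text \<open>The permutation enters only through the image of \<open>{t..<N}\<close>, so rearranging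
  \<open>p\<close> within that range leaves the item unchanged. This is what hides the order of the
  remaining agents from an online algorithm.\<close>

definition triangular_item :: "nat \<Rightarrow> real \<Rightarrow> (nat \<Rightarrow> nat) \<Rightarrow> nat \<Rightarrow> item" where
  "triangular_item N V p t =
     \<lparr>item_supply = 1, item_value = (\<lambda>i. if i \<in> p ` {t..<N} then V ^ t else 0)\<rparr>"

definition triangular_instance :: "nat \<Rightarrow> real \<Rightarrow> (nat \<Rightarrow> nat) \<Rightarrow> item list" where
  "triangular_instance N V p = map (triangular_item N V p) [0..<N]"

definition diagonal_welfare :: "nat \<Rightarrow> real \<Rightarrow> real" where
  "diagonal_welfare N V = root N (\<Prod>j<N. V ^ j)"

lemma length_triangular_instance [simp]: "length (triangular_instance N V p) = N"
  by (simp add: triangular_instance_def)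

lemma nth_triangular_instance [simp]:
  "t < N \<Longrightarrow> triangular_instance N V p ! t = triangular_item N V p t"
  by (simp add: triangular_instance_def)

lemma permutes_lessThan_less: "p permutes {..<N} \<Longrightarrow> j < N \<Longrightarrow> p j < (N::nat)"
  by (metis lessThan_iff permutes_in_image)

lemma triangular_instance_in_instances:
  assumes "p permutes {..<N}" "0 \<le> V"
  shows "triangular_instance N V p \<in> instances N"
  using assms permutes_lessThan_less[OF assms(1)]
  by (fastforce simp: instances_def triangular_instance_def valid_item_def triangular_item_def)

lemma utility_triangular_instance:
  assumes "p permutes {..<N}" "j < N"
  shows "utility (triangular_instance N V p) x (p j) = (\<Sum>s\<le>j. x (p j) s * V ^ s)"
proof -
  have "p j \<in> p ` {t..<N} \<longleftrightarrow> t \<le> j" for t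
    using permutes_inj[OF assms(1)] assms(2) by (auto simp: inj_image_mem_iff)
  then have "utility (triangular_instance N V p) x (p j) =
      (\<Sum>t<N. if t \<in> {..j} then x (p j) t * V ^ t else 0)"
    by (simp add: utility_def triangular_item_def if_distrib cong: if_cong)
  also have "\<dots> = (\<Sum>s\<le>j. x (p j) s * V ^ s)"
    using assms(2) by (subst sum.inter_restrict[symmetric]) (auto intro!: sum.cong)
  finally show ?thesis .
qed

text \<open>Agent \<open>p j\<close> is measured in units of its utility \<open>V ^ j\<close> under
  the diagonal allocation. That allocation becomes the all-ones vector, where AM-GM is
  tight.\<close>

definition relative_utility ::
  "nat \<Rightarrow> real \<Rightarrow> (nat \<Rightarrow> nat) \<Rightarrow> (nat \<Rightarrow> nat \<Rightarrow> real) \<Rightarrow> nat \<Rightarrow> real" where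
  "relative_utility N V p x j = utility (triangular_instance N V p) x (p j) / V ^ j"

lemma relative_utility_eq:
  assumes "p permutes {..<N}" "j < N"
  shows "relative_utility N V p x j = (\<Sum>s\<le>j. V ^ s / V ^ j * x (p j) s)"
  by (simp add: relative_utility_def utility_triangular_instance[OF assms]
      sum_divide_distrib mult.commute)

lemma diagonal_welfare_pos: "0 < N \<Longrightarrow> 0 < V \<Longrightarrow> 0 < diagonal_welfare N V"
  by (simp add: diagonal_welfare_def prod_pos)

lemma nash_welfare_triangular_instance:
  assumes "p permutes {..<N}" "0 < V"
  shows "nash_welfare N (triangular_instance N V p) x =
    diagonal_welfare N V * root N (\<Prod>j<N. relative_utility N V p x j)"
proof -
  have "(\<Prod>i<N. utility (triangular_instance N V p) x i) =
      (\<Prod>j<N. utility (triangular_instance N V p) x (p j))"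
    using prod.permute[OF assms(1)] by (simp add: o_def)
  also have "\<dots> = (\<Prod>j<N. V ^ j * relative_utility N V p x j)"
    using assms(2) by (simp add: relative_utility_def)
  finally show ?thesis
    by (simp add: nash_welfare_def diagonal_welfare_def prod.distrib real_root_mult)
qed

lemma allocation_triangular_instance:
  assumes "p permutes {..<N}" "x \<in> allocations N (triangular_instance N V p)" "t < N"
  shows "i < N \<Longrightarrow> 0 \<le> x i t" "(\<Sum>j<N. x (p j) t) \<le> 1"
proof -
  have "(\<Sum>j<N. x (p j) t) = (\<Sum>i<N. x i t)"
    using sum.permute[OF assms(1), of "\<lambda>i. x i t"] by (simp add: o_def)
  then show "i < N \<Longrightarrow> 0 \<le> x i t" "(\<Sum>j<N. x (p j) t) \<le> 1"
    using assms by (auto simp: allocations_def triangular_item_def)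
qed

lemma relative_utility_nonneg:
  assumes "p permutes {..<N}" "0 < V" "x \<in> allocations N (triangular_instance N V p)" "j < N"
  shows "0 \<le> relative_utility N V p x j"
  unfolding relative_utility_eq[OF assms(1,4)]
  using assms allocation_triangular_instance(1)[OF assms(1,3)]
    permutes_lessThan_less[OF assms(1,4)]
  by (intro sum_nonneg mult_nonneg_nonneg) auto

text \<open>As values do not decrease over time, one unit of item \<open>s\<close> adds at most
  \<open>V ^ s / V ^ j \<le> 1\<close> to the relative utility of agent \<open>p j\<close>. There
  are \<open>N\<close> items of unit supply.\<close>

lemma sum_relative_utility_le:
  assumes p: "p permutes {..<N}" and V: "1 \<le> V"
    and x: "x \<in> allocations N (triangular_instance N V p)"
  shows "(\<Sum>j<N. relative_utility N V p x j) \<le> real N"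
proof -
  have "(\<Sum>j<N. relative_utility N V p x j) = (\<Sum>j<N. \<Sum>s\<le>j. V ^ s / V ^ j * x (p j) s)"
    using p by (simp add: relative_utility_eq)
  also have "\<dots> \<le> (\<Sum>j<N. \<Sum>s\<le>j. x (p j) s)"
    using V allocation_triangular_instance(1)[OF p x] permutes_lessThan_less[OF p]
    by (intro sum_mono mult_left_le_one_le) (auto simp: divide_le_eq_1 power_increasing)
  also have "\<dots> \<le> (\<Sum>j<N. \<Sum>s<N. x (p j) s)"
    using allocation_triangular_instance(1)[OF p x] permutes_lessThan_less[OF p]
    by (intro sum_mono sum_mono2) auto
  also have "\<dots> = (\<Sum>s<N. \<Sum>j<N. x (p j) s)"
    by (rule sum.swap)
  also have "\<dots> \<le> (\<Sum>s<N. 1)"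
    using allocation_triangular_instance(2)[OF p x] by (intro sum_mono) auto
  finally show ?thesis by simp
qed

section \<open>Optimal welfare and impartiality ratio\<close>

lemma nash_welfare_le_diagonal_welfare:
  assumes p: "p permutes {..<N}" and "0 < N" "1 \<le> V"
    and x: "x \<in> allocations N (triangular_instance N V p)"
  shows "nash_welfare N (triangular_instance N V p) x \<le> diagonal_welfare N V"
proof -
  have "root N (\<Prod>j<N. relative_utility N V p x j) \<le> (\<Sum>j<N. relative_utility N V p x j) / N"
    using assms by (intro root_arith_geom_mean relative_utility_nonneg) auto
  also have "\<dots> \<le> 1"
    using sum_relative_utility_le[OF p _ x] assms by (simp add: divide_le_eq_1)
  finally show ?thesis
    using assms diagonal_welfare_pos[of N V]
    by (simp add: nash_welfare_triangular_instance mult_left_le)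
qed

lemma diagonal_allocation:
  assumes p: "p permutes {..<N}" and "0 < N" "1 \<le> V"
  obtains x where "x \<in> allocations N (triangular_instance N V p)"
    "nash_welfare N (triangular_instance N V p) x = diagonal_welfare N V"
proof
  define x :: "nat \<Rightarrow> nat \<Rightarrow> real" where "x = (\<lambda>i t. of_bool (i = p t))"
  have "(\<Sum>i<N. x i t) \<le> 1" for t
    by (simp add: x_def of_bool_def sum.delta)
  then show "x \<in> allocations N (triangular_instance N V p)"
    by (auto simp: allocations_def triangular_item_def x_def)
  have "relative_utility N V p x j = 1" if "j < N" for j
  proof -
    have "p j = p s \<longleftrightarrow> j = s" for s
      using permutes_inj[OF p] by (auto dest: injD)
    then have "relative_utility N V p x j = (\<Sum>s\<le>j. if j = s then 1 else 0)"
      unfolding relative_utility_eq[OF p that] using \<open>1 \<le> V\<close>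
      by (intro sum.cong) (auto simp: x_def)
    then show ?thesis by simp
  qed
  then show "nash_welfare N (triangular_instance N V p) x = diagonal_welfare N V"
    using assms by (simp add: nash_welfare_triangular_instance)
qed

lemma diagonal_welfare_le_optimal:
  assumes p: "p permutes {..<N}" and "0 < N" "1 \<le> V"
  shows "diagonal_welfare N V \<le> optimal_nash_welfare N (triangular_instance N V p)"
proof -
  obtain x where "x \<in> allocations N (triangular_instance N V p)"
    "nash_welfare N (triangular_instance N V p) x = diagonal_welfare N V"
    using diagonal_allocation[OF assms] by blast
  \<comment> \<open>A real-valued \<open>SUP\<close> bounds its elements only if the set is bounded
    above; the AM-GM estimate provides this.\<close>
  moreover have "bdd_above (nash_welfare N (triangular_instance N V p) `
      allocations N (triangular_instance N V p))"
    using nash_welfare_le_diagonal_welfare[OF assms] by (auto intro!: bdd_aboveI)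
  ultimately show ?thesis
    unfolding optimal_nash_welfare_def by (metis cSUP_upper)
qed

text \<open>Equality in AM-GM fixes the utilities of all optimal allocations, not only of the diagonal one.\<close>

lemma impartiality_ratio_triangular_instance:
  assumes p: "p permutes {..<N}" and "0 < N" "1 \<le> V"
  shows "impartiality_ratio N (triangular_instance N V p) \<le> ennreal (V ^ (N - 1))"
proof -
  let ?I = "triangular_instance N V p"
  have "impartial_allocation N (V ^ (N - 1)) ?I x" if opt: "nash_maximizing N ?I x" for x
  proof -
    have x: "x \<in> allocations N ?I" using opt by (simp add: nash_maximizing_def)
    obtain y where "y \<in> allocations N ?I" "nash_welfare N ?I y = diagonal_welfare N V"
      using diagonal_allocation[OF assms] by blast
    then have "nash_welfare N ?I x = diagonal_welfare N V"
      using opt nash_welfare_le_diagonal_welfare[OF assms x] by (force simp: nash_maximizing_def)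
    then have "root N (\<Prod>j<N. relative_utility N V p x j) = 1"
      using assms diagonal_welfare_pos[of N V] by (simp add: nash_welfare_triangular_instance)
    then have "(\<Prod>j<N. relative_utility N V p x j) = 1"
      using \<open>0 < N\<close> by simp
    then have rel: "relative_utility N V p x j = 1" if "j < N" for j
      using arith_geom_mean_eq[of N "relative_utility N V p x", OF _ _ _ that]
        relative_utility_nonneg[OF p _ x] sum_relative_utility_le[OF p \<open>1 \<le> V\<close> x] \<open>1 \<le> V\<close>
      by simp
    \<comment> \<open>Relative utility 1 means that agent \<open>p j\<close> has utility exactly
      \<open>V ^ j\<close>, with \<open>j\<close> between 0 and \<open>N - 1\<close>.\<close>
    have bounds: "1 \<le> utility ?I x i \<and> utility ?I x i \<le> V ^ (N - 1)" if "i < N" for i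
    proof -
      have "i \<in> p ` {..<N}" using permutes_image[OF p] that by simp
      then obtain j where j: "i = p j" "j < N" by blast
      then have "utility ?I x i = V ^ j"
        using rel[OF j(2)] assms by (simp add: relative_utility_def)
      then show ?thesis using power_increasing[of j "N - 1" V] \<open>j < N\<close> \<open>1 \<le> V\<close> by simp
    qed
    have "utility ?I x i \<le> V ^ (N - 1) * utility ?I x j" if "i < N" "j < N" for i j
    proof -
      have "V ^ (N - 1) * 1 \<le> V ^ (N - 1) * utility ?I x j"
        using bounds[OF \<open>j < N\<close>] \<open>1 \<le> V\<close> by (intro mult_left_mono) auto
      then show ?thesis using bounds[OF \<open>i < N\<close>] by linarith
    qed
    then show ?thesis by (simp add: impartial_allocation_def)
  qed
  then show ?thesis
    unfolding impartiality_ratio_def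
    by (intro INF_lower) (simp add: impartial_instance_def)
qed

section \<open>Online algorithms under a random permutation\<close>

lemma online_allocation_in_allocations:
  assumes A: "A \<in> deterministic_online_algorithms N" and I: "I \<in> instances N"
  shows "online_allocation A I \<in> allocations N I"
proof -
  have "(\<forall>i<N. 0 \<le> A (take (Suc t) I) i) \<and> (\<Sum>i<N. A (take (Suc t) I) i) \<le> item_supply (I ! t)"
    if "t < length I" for t
  proof -
    have "take (Suc t) I \<in> instances N"
      using I by (auto simp: instances_def dest: in_set_takeD)
    moreover have "take (Suc t) I \<noteq> []" "last (take (Suc t) I) = I ! t"
      using that by (auto simp: take_Suc_conv_app_nth)
    ultimately show ?thesis
      using A unfolding deterministic_online_algorithms_def by fastforce
  qed
  then show ?thesis by (simp add: allocations_def online_allocation_def)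
qed

lemma online_allocation_triangular_instance:
  assumes "A \<in> deterministic_online_algorithms N" "p permutes {..<N}" "0 \<le> V"
  shows "online_allocation A (triangular_instance N V p) \<in> allocations N (triangular_instance N V p)"
  using assms by (intro online_allocation_in_allocations triangular_instance_in_instances)

text \<open>Swapping two positions that are at least \<open>s\<close> maps \<open>{t..<N}\<close>
  onto itself for every \<open>t \<le> s\<close>. Hence the decision on item \<open>s\<close> is
  made from the same history for both permutations.\<close>

lemma take_triangular_instance_transpose:
  assumes "s \<le> j" "j < N" "s \<le> k" "k < N"
  shows "take (Suc s) (triangular_instance N V (p \<circ> Transposition.transpose j k)) =
    take (Suc s) (triangular_instance N V p)"
proof -
  have "triangular_item N V (p \<circ> Transposition.transpose j k) t = triangular_item N V p t"
    if "t \<le> s" for t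
  proof -
    have "Transposition.transpose j k permutes {t..<N}"
      using assms that by (intro permutes_swap_id) auto
    then have "(p \<circ> Transposition.transpose j k) ` {t..<N} = p ` {t..<N}"
      by (metis image_comp permutes_image)
    then show ?thesis by (simp only: triangular_item_def)
  qed
  moreover have "take (Suc s) [0..<N] = [0..<Suc s]"
    using assms by (subst take_upt) auto
  ultimately show ?thesis
    by (simp add: triangular_instance_def take_map)
qed

text \<open>Summed over all permutations, each of the \<open>N - s\<close> positions from
  \<open>s\<close> on receives the same amount of item \<open>s\<close>. For a single permutation
  these amounts total at most 1, and there are \<open>fact N\<close> permutations.\<close>

lemma sum_online_allocation_le:
  assumes A: "A \<in> deterministic_online_algorithms N" and "0 \<le> V" and "s \<le> j" "j < N"
  shows "(real N - real s) * (\<Sum>p | p permutes {..<N}.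
    online_allocation A (triangular_instance N V p) (p j) s) \<le> fact N"
proof -
  let ?P = "{p. p permutes {..<N}}"
  let ?x = "\<lambda>p. online_allocation A (triangular_instance N V p)"
  have symm: "(\<Sum>p\<in>?P. ?x p (p k) s) = (\<Sum>p\<in>?P. ?x p (p j) s)" if "k \<in> {s..<N}" for k
  proof -
    have "Transposition.transpose j k permutes {..<N}"
      using assms that by (intro permutes_swap_id) auto
    \<comment> \<open>Composing with the transposition permutes the summands. The algorithm sees the
      same prefix, but position \<open>j\<close> is now held by agent \<open>p k\<close>.\<close>
    then have "(\<Sum>p\<in>?P. ?x p (p j) s) =
        (\<Sum>p\<in>?P. ?x (p \<circ> Transposition.transpose j k) ((p \<circ> Transposition.transpose j k) j) s)"
      by (rule sum_permutations_compose_right)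
    also have "\<dots> = (\<Sum>p\<in>?P. ?x p (p k) s)"
      using assms that by (simp add: online_allocation_def take_triangular_instance_transpose)
    finally show ?thesis by simp
  qed
  have "(real N - real s) * (\<Sum>p\<in>?P. ?x p (p j) s) = (\<Sum>k\<in>{s..<N}. \<Sum>p\<in>?P. ?x p (p j) s)"
    using assms by (simp add: of_nat_diff)
  also have "\<dots> = (\<Sum>k\<in>{s..<N}. \<Sum>p\<in>?P. ?x p (p k) s)"
    by (rule sum.cong[OF refl symm[symmetric]])
  also have "\<dots> = (\<Sum>p\<in>?P. \<Sum>k\<in>{s..<N}. ?x p (p k) s)"
    by (rule sum.swap)
  also have "\<dots> \<le> (\<Sum>p\<in>?P. 1)"
  proof (rule sum_mono)
    fix p assume "p \<in> ?P"
    then have p: "p permutes {..<N}" by simp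
    have x: "?x p \<in> allocations N (triangular_instance N V p)"
      using online_allocation_triangular_instance[OF A p \<open>0 \<le> V\<close>] .
    have "(\<Sum>k\<in>{s..<N}. ?x p (p k) s) \<le> (\<Sum>k<N. ?x p (p k) s)"
      using allocation_triangular_instance(1)[OF p x] permutes_lessThan_less[OF p] assms
      by (intro sum_mono2) auto
    also have "\<dots> \<le> 1"
      using allocation_triangular_instance(2)[OF p x] assms by simp
    finally show "(\<Sum>k\<in>{s..<N}. ?x p (p k) s) \<le> 1" .
  qed
  also have "\<dots> = fact N"
    using card_permutations[of "{..<N}" N] by simp
  finally show ?thesis .
qed

text \<open>Read backwards, this is a partial sum of the geometric series in \<open>1 / V\<close>,
  whose limit is \<open>V / (V - 1)\<close>.\<close>

lemma sum_power_div_le: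
  fixes V :: real
  assumes "1 < V"
  shows "(\<Sum>s\<le>j. V ^ s / V ^ j) \<le> V / (V - 1)"
proof -
  have "(\<Sum>s\<le>j. V ^ s / V ^ j) = (\<Sum>s<Suc j. V ^ s) / V ^ j"
    by (simp add: sum_divide_distrib lessThan_Suc_atMost)
  also have "\<dots> = (V ^ Suc j - 1) / (V - 1) / V ^ j"
    using assms by (subst geometric_sum) auto
  also have "\<dots> \<le> V ^ Suc j / (V - 1) / V ^ j"
    using assms by (intro divide_right_mono) auto
  also have "\<dots> = V / (V - 1)"
    using assms by simp
  finally show ?thesis .
qed

text \<open>The weight \<open>N - j\<close> offsets the bound \<open>1 / (N - s)\<close>, at most
  \<open>1 / (N - j)\<close>, on the mean share of agent \<open>p j\<close> in item
  \<open>s\<close>. All weighted relative utilities then have the same mean bound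
  \<open>V / (V - 1)\<close>.\<close>

lemma sum_nash_welfare_le:
  assumes A: "A \<in> deterministic_online_algorithms N" and "1 < V" "0 < N"
  shows "(\<Sum>p | p permutes {..<N}. nash_welfare N (triangular_instance N V p)
      (online_allocation A (triangular_instance N V p)))
    \<le> fact N * (V / (V - 1) / root N (fact N) * diagonal_welfare N V)"
proof -
  let ?P = "{p. p permutes {..<N}}"
  let ?x = "\<lambda>p. online_allocation A (triangular_instance N V p)"
  let ?r = "\<lambda>p. relative_utility N V p (?x p)"
  have root_fact: "0 < root N (fact N :: real)" using assms by simp
  have prod_weights: "(\<Prod>j<N. real N - real j) = fact N"
    by (simp add: fact_prod_rev atLeast0LessThan of_nat_diff)
  have "root N (\<Prod>j<N. ?r p j) \<le> (\<Sum>j<N. (real N - real j) * ?r p j) / (N * root N (fact N))"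
    if "p \<in> ?P" for p
  proof -
    have p: "p permutes {..<N}" using that by simp
    have x: "?x p \<in> allocations N (triangular_instance N V p)"
      using online_allocation_triangular_instance[OF A p] \<open>1 < V\<close> by simp
    \<comment> \<open>The weights multiply to \<open>fact N\<close>, so inserting them into the
      product costs exactly this root.\<close>
    have "root N (fact N) * root N (\<Prod>j<N. ?r p j) = root N (\<Prod>j<N. (real N - real j) * ?r p j)"
      by (simp add: prod.distrib prod_weights real_root_mult)
    also have "\<dots> \<le> (\<Sum>j<N. (real N - real j) * ?r p j) / N"
      using assms p x
      by (intro root_arith_geom_mean mult_nonneg_nonneg relative_utility_nonneg) auto
    finally show ?thesis using root_fact \<open>0 < N\<close> by (simp add: field_simps)
  qed
  then have "(\<Sum>p\<in>?P. root N (\<Prod>j<N. ?r p j)) \<le>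
      (\<Sum>p\<in>?P. (\<Sum>j<N. (real N - real j) * ?r p j) / (N * root N (fact N)))"
    by (rule sum_mono)
  also have "\<dots> = (\<Sum>j<N. \<Sum>p\<in>?P. (real N - real j) * ?r p j) / (N * root N (fact N))"
    by (subst sum.swap) (simp add: sum_divide_distrib)
  also have "\<dots> \<le> (\<Sum>j<N. fact N * (V / (V - 1))) / (N * root N (fact N))"
  proof (intro divide_right_mono sum_mono)
    fix j assume "j \<in> {..<N}"
    then have j: "j < N" by simp
    have "(\<Sum>p\<in>?P. (real N - real j) * ?r p j) =
        (\<Sum>p\<in>?P. \<Sum>s\<le>j. (real N - real j) * (V ^ s / V ^ j * ?x p (p j) s))"
      using j by (intro sum.cong refl) (simp add: relative_utility_eq sum_distrib_left)
    also have "\<dots> = (\<Sum>s\<le>j. V ^ s / V ^ j * ((real N - real j) * (\<Sum>p\<in>?P. ?x p (p j) s)))"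
      by (subst sum.swap) (simp add: sum_distrib_left sum_divide_distrib mult_ac)
    also have "\<dots> \<le> (\<Sum>s\<le>j. V ^ s / V ^ j * fact N)"
    proof (intro sum_mono mult_left_mono)
      fix s assume s: "s \<in> {..j}"
      have "0 \<le> (\<Sum>p\<in>?P. ?x p (p j) s)"
      proof (rule sum_nonneg)
        fix p assume "p \<in> ?P"
        then have p: "p permutes {..<N}" by simp
        show "0 \<le> ?x p (p j) s"
          using allocation_triangular_instance(1)[OF p online_allocation_triangular_instance[OF A p]]
            permutes_lessThan_less[OF p j] \<open>1 < V\<close> s j by simp
      qed
      \<comment> \<open>The symmetry bound for item \<open>s\<close> carries the weight
        \<open>N - s\<close>. It dominates \<open>N - j\<close> because \<open>s \<le> j\<close>,
        and the sum it multiplies is nonnegative.\<close>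
      then have "(real N - real j) * (\<Sum>p\<in>?P. ?x p (p j) s)
          \<le> (real N - real s) * (\<Sum>p\<in>?P. ?x p (p j) s)"
        using s by (intro mult_right_mono) auto
      also have "\<dots> \<le> fact N"
        using sum_online_allocation_le[OF A] assms s j by simp
      finally show "(real N - real j) * (\<Sum>p\<in>?P. ?x p (p j) s) \<le> fact N" .
    qed (use assms in auto)
    also have "\<dots> = fact N * (\<Sum>s\<le>j. V ^ s / V ^ j)"
      by (simp add: sum_distrib_left mult.commute)
    also have "\<dots> \<le> fact N * (V / (V - 1))"
      using sum_power_div_le[OF \<open>1 < V\<close>] by (intro mult_left_mono) auto
    finally show "(\<Sum>p\<in>?P. (real N - real j) * ?r p j) \<le> fact N * (V / (V - 1))" .
  qed (use root_fact in simp)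
  also have "\<dots> = fact N * (V / (V - 1) / root N (fact N))"
    using \<open>0 < N\<close> by simp
  finally have "diagonal_welfare N V * (\<Sum>p\<in>?P. root N (\<Prod>j<N. ?r p j)) \<le>
      diagonal_welfare N V * (fact N * (V / (V - 1) / root N (fact N)))"
    using diagonal_welfare_pos[of N V] assms by (intro mult_left_mono) auto
  moreover have "(\<Sum>p\<in>?P. nash_welfare N (triangular_instance N V p) (?x p)) =
      diagonal_welfare N V * (\<Sum>p\<in>?P. root N (\<Prod>j<N. ?r p j))"
    using assms by (simp add: nash_welfare_triangular_instance sum_distrib_left)
  ultimately show ?thesis by (simp add: mult_ac)
qed

section \<open>From average welfare to the competitive ratio\<close>

text \<open>A non-integrable function has Bochner integral 0, and \<open>0 \<le> c\<close> covers
  this default.\<close>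

lemma (in prob_space) integral_le_const':
  fixes f :: "'a \<Rightarrow> real"
  assumes "\<And>x. x \<in> space M \<Longrightarrow> f x \<le> c" "0 \<le> c"
  shows "(\<integral>x. f x \<partial>M) \<le> c"
proof (cases "integrable M f")
  case True
  then show ?thesis using assms by (intro integral_le_const) auto
next
  case False
  then show ?thesis using assms by (simp add: not_integrable_integral_eq)
qed

text \<open>This is the averaging step of Yao's principle: a bound on the mean over
  \<open>P\<close>, valid for each deterministic algorithm, yields one \<open>p\<close> that is hard
  for the randomized one.\<close>

lemma (in prob_space) exists_integral_le_average:
  fixes f :: "'b \<Rightarrow> 'a \<Rightarrow> real"
  assumes "finite P" "P \<noteq> {}" "0 \<le> c"
    and "\<And>x. x \<in> space M \<Longrightarrow> (\<Sum>p\<in>P. f p x) \<le> real (card P) * c"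
  shows "\<exists>p\<in>P. (\<integral>x. f p x \<partial>M) \<le> c"
proof (rule ccontr)
  assume "\<not> ?thesis"
  then have less: "c < (\<integral>x. f p x \<partial>M)" if "p \<in> P" for p
    using that by (auto simp: not_le)
  \<comment> \<open>An integral above \<open>c \<ge> 0\<close> is not the default value 0, so the
    function is integrable and the sum can be moved inside.\<close>
  then have int: "integrable M (f p)" if "p \<in> P" for p
    using that \<open>0 \<le> c\<close> by (metis not_integrable_integral_eq not_le)
  have "real (card P) * c < (\<Sum>p\<in>P. \<integral>x. f p x \<partial>M)"
    using sum_strict_mono[of P "\<lambda>_. c"] less assms by simp
  also have "\<dots> = (\<integral>x. (\<Sum>p\<in>P. f p x) \<partial>M)"
    using int by simp
  also have "\<dots> \<le> real (card P) * c"
    using assms by (intro integral_le_const') auto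
  finally show False by simp
qed

lemma competitive_ratio_ge:
  assumes "I \<in> instances N" "impartiality_ratio N I \<le> ennreal \<mu>"
    and "0 < c" "0 < D" "D \<le> optimal_nash_welfare N I" "expected_nash_welfare N M I \<le> c * D"
  shows "ennreal (1 / c) \<le> competitive_ratio N \<mu> M"
proof -
  have "ennreal (1 / c) = ennreal D / ennreal (c * D)"
    using assms by (subst divide_ennreal) auto
  also have "\<dots> \<le> ennreal (optimal_nash_welfare N I) / ennreal (expected_nash_welfare N M I)"
  proof (cases "0 < expected_nash_welfare N M I")
    case True
    then have "D / (c * D) \<le> optimal_nash_welfare N I / expected_nash_welfare N M I"
      using assms by (intro frac_le) auto
    then show ?thesis
      using assms True by (simp add: divide_ennreal ennreal_leI)
  next
    \<comment> \<open>\<open>ennreal\<close> sends a nonpositive denominator to 0; as the numerator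
      is positive, the quotient is infinite.\<close>
    case False
    then show ?thesis using assms by (simp add: ennreal_neg ennreal_eq_0_iff)
  qed
  also have "\<dots> \<le> competitive_ratio N \<mu> M"
    unfolding competitive_ratio_def using assms by (intro SUP_upper) auto
  finally show ?thesis .
qed

text \<open>With \<open>V = 1\<close> the triangular instance has impartiality ratio at most 1, so
  it is admissible for every \<open>\<mu> \<ge> 1\<close>. This settles the range of small
  \<open>\<mu>\<close>.\<close>

lemma competitive_ratio_ge_one:
  assumes M: "online_algorithm N M" and "0 < N" "1 \<le> \<mu>"
  shows "1 \<le> competitive_ratio N \<mu> M"
proof -
  let ?I = "triangular_instance N 1 id"
  interpret prob_space M using M by (simp add: online_algorithm_def)
  have id: "id permutes {..<N}" by (rule permutes_id)
  have I: "?I \<in> instances N" using triangular_instance_in_instances[OF id] by simp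
  have "expected_nash_welfare N M ?I \<le> diagonal_welfare N 1"
    unfolding expected_nash_welfare_def
  proof (rule integral_le_const')
    fix A assume "A \<in> space M"
    then have "A \<in> deterministic_online_algorithms N"
      using M by (auto simp: online_algorithm_def)
    then show "nash_welfare N ?I (online_allocation A ?I) \<le> diagonal_welfare N 1"
      using nash_welfare_le_diagonal_welfare[OF id] online_allocation_in_allocations I \<open>0 < N\<close>
      by simp
  qed (use diagonal_welfare_pos[of N 1] \<open>0 < N\<close> in simp)
  moreover have "impartiality_ratio N ?I \<le> ennreal \<mu>"
    using impartiality_ratio_triangular_instance[OF id \<open>0 < N\<close>, of 1] \<open>1 \<le> \<mu>\<close>
    by (auto intro: order_trans)
  ultimately have "ennreal (1 / 1) \<le> competitive_ratio N \<mu> M"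
    using I diagonal_welfare_pos[of N 1] diagonal_welfare_le_optimal[OF id, of 1] \<open>0 < N\<close>
    by (intro competitive_ratio_ge[where I = ?I and D = "diagonal_welfare N 1"]) auto
  then show ?thesis by simp
qed

lemma competitive_ratio_triangular:
  assumes M: "online_algorithm N M" and "2 \<le> N" "1 < \<mu>"
  shows "ennreal (real N / exp 1 * (1 - exp (- ln \<mu> / (real N - 1)))) \<le> competitive_ratio N \<mu> M"
proof -
  interpret prob_space M using M by (simp add: online_algorithm_def)
  define V where "V = exp (ln \<mu> / (real N - 1))"
  have V: "1 < V" using assms by (simp add: V_def)
  have "V ^ (N - 1) = exp (ln \<mu>)"
    using assms by (simp add: V_def of_nat_diff flip: exp_of_nat_mult)
  then have pow: "V ^ (N - 1) = \<mu>" using assms by simp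
  \<comment> \<open>The fraction of the optimum that an algorithm can secure on average; its inverse
    is \<open>root N (fact N) * (1 - 1 / V)\<close>.\<close>
  define c where "c = V / (V - 1) / root N (fact N)"
  let ?P = "{p. p permutes {..<N}}"
  have c: "0 < c" using V \<open>2 \<le> N\<close> by (simp add: c_def)
  have D: "0 < diagonal_welfare N V" using diagonal_welfare_pos V \<open>2 \<le> N\<close> by simp
  have "id \<in> ?P" by (simp add: permutes_id)
  then have "?P \<noteq> {}" by blast
  moreover have "(\<Sum>p\<in>?P. nash_welfare N (triangular_instance N V p)
      (online_allocation A (triangular_instance N V p)))
    \<le> real (card ?P) * (c * diagonal_welfare N V)" if "A \<in> space M" for A
  proof -
    have "A \<in> deterministic_online_algorithms N"
      using M that by (auto simp: online_algorithm_def)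
    then show ?thesis
      using sum_nash_welfare_le[of A N V] V \<open>2 \<le> N\<close> card_permutations[of "{..<N}" N]
      unfolding c_def by simp
  qed
  ultimately have "\<exists>p\<in>?P. (\<integral>A. nash_welfare N (triangular_instance N V p)
      (online_allocation A (triangular_instance N V p)) \<partial>M) \<le> c * diagonal_welfare N V"
    using c D by (intro exists_integral_le_average) (auto simp: finite_permutations)
  then obtain p where p: "p permutes {..<N}"
    and "expected_nash_welfare N M (triangular_instance N V p) \<le> c * diagonal_welfare N V"
    by (auto simp: expected_nash_welfare_def)
  then have "ennreal (1 / c) \<le> competitive_ratio N \<mu> M"
    using V \<open>2 \<le> N\<close> c D pow impartiality_ratio_triangular_instance[OF p, of V]
      triangular_instance_in_instances[OF p, of V] diagonal_welfare_le_optimal[OF p, of V]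
    by (intro competitive_ratio_ge[where I = "triangular_instance N V p"
          and D = "diagonal_welfare N V"]) auto
  moreover have "real N / exp 1 * (1 - exp (- ln \<mu> / (real N - 1))) \<le> 1 / c"
  proof -
    have "real N / exp 1 = root N ((real N / exp 1) ^ N)"
      using \<open>2 \<le> N\<close> by (simp add: real_root_power_cancel)
    also have "\<dots> \<le> root N (fact N)"
      using power_div_exp_le_fact[of N] \<open>2 \<le> N\<close> by simp
    finally have "real N / exp 1 * (1 - 1 / V) \<le> root N (fact N) * (1 - 1 / V)"
      using V by (intro mult_right_mono) auto
    also have "\<dots> = 1 / c" using V by (simp add: c_def field_simps)
    finally show ?thesis by (simp add: V_def exp_minus inverse_eq_divide)
  qed
  ultimately show ?thesis by (meson ennreal_leI order_trans)
qed

section \<open>The shape of the lower bound and the error term\<close>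

text \<open>Here \<open>L\<close> stands for \<open>ln \<mu>\<close>. The assumption
  \<open>exp 1 < L\<close> ensures \<open>ln (L + 1) > 1\<close>, which absorbs lower-order
  terms.\<close>

lemma min_le_triangular_bound:
  fixes L :: real
  assumes "2 \<le> N" "exp 1 < L"
  shows "min (L / (2 * exp 1 * ln (L + 1))) ((real N - 1) / exp 1) \<le>
    real N / exp 1 * (1 - exp (- L / (real N - 1)))"
proof -
  define n where "n = real N - 1"
  have n: "1 \<le> n" "real N = n + 1" using assms by (auto simp: n_def)
  have "1 < (exp 1 :: real)" by simp
  then have "1 < L" using assms(2) by linarith
  have "ln (exp 1) < ln (L + 1)" using assms \<open>1 < L\<close> by (subst ln_less_cancel_iff) auto
  then have ln1: "1 < ln (L + 1)" by simp
  \<comment> \<open>The threshold says that \<open>V = exp (L / n)\<close> is at least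
    \<open>N = n + 1\<close>; then \<open>1 - 1 / V\<close> is at least \<open>1 - 1 / N\<close>,
    which gives the second term of the minimum.\<close>
  show ?thesis
  proof (cases "n * ln (n + 1) \<le> L")
    case True
    then have "exp (- L / n) \<le> exp (- ln (n + 1))"
      using n by (simp add: field_simps)
    also have "\<dots> = 1 / (n + 1)" using n by (simp add: exp_minus inverse_eq_divide)
    finally have "(n + 1) / exp 1 * (1 - 1 / (n + 1)) \<le> (n + 1) / exp 1 * (1 - exp (- L / n))"
      using n by (intro mult_left_mono) auto
    moreover have "(n + 1) / exp 1 * (1 - 1 / (n + 1)) = n / exp 1"
    proof -
      have "(n + 1) * (1 - 1 / (n + 1)) = n" using n by (simp add: right_diff_distrib)
      then show ?thesis by (metis times_divide_eq_left)
    qed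
    ultimately show ?thesis using n by (simp add: min_le_iff_disj)
  next
    case False
    \<comment> \<open>This is used as \<open>1 - exp (- x) \<ge> x / (1 + x)\<close> at
      \<open>x = L / n\<close>.\<close>
    have "1 + L / n \<le> exp (L / n)" by (rule exp_ge_add_one_self)
    then have "exp (- (L / n)) \<le> 1 / (1 + L / n)"
      using n \<open>1 < L\<close> by (simp add: exp_minus inverse_eq_divide frac_le add_pos_pos)
    then have bound: "L / (n + L) \<le> 1 - exp (- L / n)"
      using n \<open>1 < L\<close> by (simp add: field_simps)
    have "L * (n + L) \<le> (n + 1) * L * (2 * ln (L + 1))"
    proof -
      \<comment> \<open>If \<open>L \<le> n\<close>, the factor 2 suffices. Otherwise
        \<open>n < L\<close>, and failure of the threshold gives
        \<open>L < n * ln (n + 1) \<le> n * ln (L + 1)\<close>.\<close>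
      have "n + L \<le> (n + 1) * (2 * ln (L + 1))"
      proof (cases "L \<le> n")
        case True
        then have "n + L \<le> (n + 1) * 2" by simp
        also have "\<dots> \<le> (n + 1) * (2 * ln (L + 1))" using n ln1 by (intro mult_left_mono) auto
        finally show ?thesis .
      next
        case False
        then have "ln (n + 1) \<le> ln (L + 1)" using n by simp
        then have "n * ln (n + 1) \<le> n * ln (L + 1)" using n by (intro mult_left_mono) auto
        then have "L \<le> n * ln (L + 1)" using \<open>\<not> n * ln (n + 1) \<le> L\<close> by linarith
        moreover have "n * 1 \<le> n * ln (L + 1)" using n ln1 by (intro mult_left_mono) auto
        ultimately show ?thesis using ln1 by (simp add: algebra_simps)
      qed
      then show ?thesis using \<open>1 < L\<close> by (simp add: mult.assoc mult.left_commute[of _ L])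
    qed
    then have "L / (2 * ln (L + 1)) \<le> (n + 1) * (L / (n + L))"
      using n \<open>1 < L\<close> ln1 by (simp add: field_simps)
    then have "L / (2 * ln (L + 1)) / exp 1 \<le> (n + 1) * (L / (n + L)) / exp 1"
      by (intro divide_right_mono) auto
    then have "L / (2 * exp 1 * ln (L + 1)) \<le> (n + 1) / exp 1 * (L / (n + L))"
      by (simp add: mult_ac)
    also have "\<dots> \<le> (n + 1) / exp 1 * (1 - exp (- L / n))"
      using bound n by (intro mult_left_mono) auto
    finally show ?thesis using n by (simp add: min_le_iff_disj)
  qed
qed

theorem theorem8:
  "\<exists>\<epsilon> :: real \<Rightarrow> real. (\<epsilon> \<longlongrightarrow> 0) at_top \<and>
     (\<forall>N::nat. \<forall>\<mu>::real. \<forall>M::algorithm measure.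
        1 \<le> N \<longrightarrow> 1 \<le> \<mu> \<longrightarrow> online_algorithm N M \<longrightarrow>
        ennreal (min (ln \<mu> powr (1 - \<epsilon> \<mu>)) ((real N - 1) / exp 1)) \<le> competitive_ratio N \<mu> M)"
proof -
  \<comment> \<open>Chosen so that \<open>ln \<mu> powr \<epsilon> \<mu>\<close> is the denominator
    \<open>2 * exp 1 * ln (ln \<mu> + 1)\<close> once \<open>ln \<mu> > exp 1\<close>, independently
    of \<open>N\<close>. Below that, the value 1 makes the power at most 1.\<close>
  define \<epsilon> :: "real \<Rightarrow> real" where
    "\<epsilon> \<mu> = (if ln \<mu> \<le> exp 1 then 1 else ln (2 * exp 1 * ln (ln \<mu> + 1)) / ln (ln \<mu>))" for \<mu>
  have "((\<lambda>\<mu>::real. ln (2 * exp 1 * ln (ln \<mu> + 1)) / ln (ln \<mu>)) \<longlongrightarrow> 0) at_top"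
    by real_asymp
  moreover have "\<forall>\<^sub>F \<mu> in at_top. exp 1 < ln (\<mu>::real)"
    by real_asymp
  then have "\<forall>\<^sub>F \<mu> in at_top. ln (2 * exp 1 * ln (ln \<mu> + 1)) / ln (ln \<mu>) = \<epsilon> \<mu>"
    by eventually_elim (simp add: \<epsilon>_def)
  ultimately have "(\<epsilon> \<longlongrightarrow> 0) at_top"
    by (rule Lim_transform_eventually)
  moreover have "ennreal (min (ln \<mu> powr (1 - \<epsilon> \<mu>)) ((real N - 1) / exp 1)) \<le> competitive_ratio N \<mu> M"
    if "1 \<le> N" "1 \<le> \<mu>" and M: "online_algorithm N M" for N \<mu> M
  proof -
    consider "N = 1" | "ln \<mu> \<le> exp 1" | "2 \<le> N" "exp 1 < ln \<mu>"
      using \<open>1 \<le> N\<close> by linarith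
    then show ?thesis
    proof cases
      \<comment> \<open>For a single agent, \<open>(N - 1) / exp 1\<close> is 0.\<close>
      case 1
      then show ?thesis by (simp add: ennreal_neg min_le_iff_disj)
    next
      case 2
      then have "ennreal (min (ln \<mu> powr (1 - \<epsilon> \<mu>)) ((real N - 1) / exp 1)) \<le> ennreal 1"
        by (intro ennreal_leI) (simp add: \<epsilon>_def min_le_iff_disj)
      also have "\<dots> \<le> competitive_ratio N \<mu> M"
        using competitive_ratio_ge_one[OF M] that by simp
      finally show ?thesis .
    next
      case 3
      have "1 < (exp 1 :: real)" by simp
      then have L: "1 < ln \<mu>" using 3 by linarith
      then have "ln 1 < ln \<mu>" by simp
      then have "1 < \<mu>" using \<open>1 \<le> \<mu>\<close> by (simp del: ln_one add: ln_less_cancel_iff)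
      have "ln \<mu> powr \<epsilon> \<mu> = 2 * exp 1 * ln (ln \<mu> + 1)"
        using 3 L by (simp add: powr_def \<epsilon>_def)
      then have "ln \<mu> powr (1 - \<epsilon> \<mu>) = ln \<mu> / (2 * exp 1 * ln (ln \<mu> + 1))"
        using L by (simp add: powr_diff)
      then have "ennreal (min (ln \<mu> powr (1 - \<epsilon> \<mu>)) ((real N - 1) / exp 1)) \<le>
          ennreal (real N / exp 1 * (1 - exp (- ln \<mu> / (real N - 1))))"
        using min_le_triangular_bound[OF 3] by (intro ennreal_leI) simp
      also have "\<dots> \<le> competitive_ratio N \<mu> M"
        using competitive_ratio_triangular[OF M] 3 \<open>1 < \<mu>\<close> by simp
      finally show ?thesis .
    qed
  qed
  ultimately show ?thesis by blast
qed

end
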